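(* For $i=1,2$ let $\mathcal{H}_i\subseteq\mathcal{K}_i$ be complex Hilbert spaces, let $T_i\in\mathcal{B}(\mathcal{H}_i)$ be a contraction and let $W_i\in\mathcal{B}(\mathcal{K}_i)$ be a co-isometric extension of $T_i$. Let $X\in\mathcal{B}(\mathcal{H}_1,\mathcal{H}_2)$. Suppose $Q\in\mathcal{B}(\mathcal{H}_1)$ and $\overline{Q}\in\mathcal{B}(\mathcal{K}_1)$ are contractions with $\mathcal{H}_1$ reducing $\overline{Q}$ and $\overline{Q}|_{\mathcal{H}_1}=Q$. (i) If $XT_1Q=T_2X$, then there exists an extension $Y\in\mathcal{B}(\mathcal{K}_1,\mathcal{K}_2)$ of $X$ such that $YW_1\overline{Q}=W_2Y$. (ii) If $XQT_1=T_2X$, then there exists an extension $Y\in\mathcal{B}(\mathcal{K}_1,\mathcal{K}_2)$ of $X$ such that $Y\overline{Q}W_1=W_2Y$. Suppose instead $Q\in\mathcal{B}(\mathcal{H}_2)$ and $\overline{Q}\in\mathcal{B}(\mathcal{K}_2)$ are unitaries with $\mathcal{H}_2$ reducing $\overline{Q}$ and $\overline{Q}|_{\mathcal{H}_2}=Q$. (iii) If $QXT_1=T_2X$, then there exists an extension $Y\in\mathcal{B}(\mathcal{K}_1,\mathcal{K}_2)$ of $X$ such that $\overline{Q}YW_1=W_2Y$. In all cases $T_2^nX=P_{\mathcal{H}_2}W_2^nY|_{\mathcal{H}_1}$ and $XT_1^n=P_{\mathcal{H}_2}YW_1^n|_{\mathcal{H}_1}$ for all integers $n\geq 0$, and $Y$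 can be chosen such that $\|Y\|=\|X\|$.
   Context: For Hilbert spaces $\mathcal{H}_1\subseteq\mathcal{K}_1$, $\mathcal{H}_2\subseteq\mathcal{K}_2$, $S\in\mathcal{B}(\mathcal{K}_1,\mathcal{K}_2)$ is an extension of $T\in\mathcal{B}(\mathcal{H}_1,\mathcal{H}_2)$ if $Sh=Th$ for all $h\in\mathcal{H}_1$. A co-isometric extension of $T_i\in\mathcal{B}(\mathcal{H}_i)$ is an extension $W_i\in\mathcal{B}(\mathcal{K}_i)$ with $W_iW_i^*=I$. $P_{\mathcal{H}_2}$ is the orthogonal projection onto $\mathcal{H}_2$. *)

theory Defs
  imports "HOL-Analysis.Analysis"
begin

class complex_vector = real_vector +
  fixes scaleC :: "complex \<Rightarrow> 'a \<Rightarrow> 'a" (infixr \<open>*\<^sub>C\<close> 75)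
  assumes scaleC_add_right: "scaleC a (x + y) = scaleC a x + scaleC a y"
    and scaleC_add_left: "scaleC (a + b) x = scaleC a x + scaleC b x"
    and scaleC_scaleC: "scaleC a (scaleC b x) = scaleC (a * b) x"
    and scaleC_one: "scaleC 1 x = x"
    and scaleR_scaleC: "scaleR r x = scaleC (complex_of_real r) x"

class complex_inner = complex_vector + real_normed_vector +
  fixes cinner :: "'a \<Rightarrow> 'a \<Rightarrow> complex"
  assumes cinner_commute: "cinner x y = cnj (cinner y x)"
    and cinner_add_left: "cinner (x + y) z = cinner x z + cinner y z"
    and cinner_scaleC_left: "cinner (scaleC r x) y = cnj r * cinner x y"
    and cinner_Re_nonneg: "0 \<le> Re (cinner x x)"
    and cinner_eq_zero_iff: "cinner x x = 0 \<longleftrightarrow> x = 0"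
    and norm_eq_sqrt_cinner: "norm x = sqrt (Re (cinner x x))"

class chilbert_space = complex_inner + complete_space

definition closed_csubspace :: "'a::complex_inner set \<Rightarrow> bool" where
  "closed_csubspace H \<longleftrightarrow> 0 \<in> H \<and> (\<forall>x\<in>H. \<forall>y\<in>H. x + y \<in> H)
     \<and> (\<forall>c. \<forall>x\<in>H. scaleC c x \<in> H) \<and> closed H"

definition orth :: "'a::complex_inner set \<Rightarrow> 'a set" where
  "orth H = {y. \<forall>x\<in>H. cinner x y = 0}"

definition proj :: "'a::complex_inner set \<Rightarrow> 'a \<Rightarrow> 'a" where
  "proj H y = (THE x. x \<in> H \<and> y - x \<in> orth H)"

text \<open>T is a bounded (complex-linear) operator from H1 to H2; only its values on H1 matter.\<close>
definition bop_on :: "'a::complex_inner set \<Rightarrow> 'b::complex_inner set \<Rightarrow> ('a \<Rightarrow> 'b) \<Rightarrow> bool" where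
  "bop_on H1 H2 T \<longleftrightarrow> (\<forall>x\<in>H1. T x \<in> H2)
     \<and> (\<forall>x\<in>H1. \<forall>y\<in>H1. T (x + y) = T x + T y)
     \<and> (\<forall>c. \<forall>x\<in>H1. T (scaleC c x) = scaleC c (T x))
     \<and> (\<exists>C. \<forall>x\<in>H1. norm (T x) \<le> C * norm x)"

definition onorm_on :: "'a::complex_inner set \<Rightarrow> ('a \<Rightarrow> 'b::complex_inner) \<Rightarrow> real" where
  "onorm_on H T = (SUP x\<in>H. norm (T x) / norm x)"

definition contraction_on :: "'a::complex_inner set \<Rightarrow> ('a \<Rightarrow> 'a) \<Rightarrow> bool" where
  "contraction_on H T \<longleftrightarrow> bop_on H H T \<and> (\<forall>x\<in>H. norm (T x) \<le> norm x)"

definition adjoint_on :: "'a::complex_inner set \<Rightarrow> ('a \<Rightarrow> 'a) \<Rightarrow> ('a \<Rightarrow> 'a) \<Rightarrow> bool" where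
  "adjoint_on H T T' \<longleftrightarrow> bop_on H H T \<and> bop_on H H T'
     \<and> (\<forall>x\<in>H. \<forall>y\<in>H. cinner (T x) y = cinner x (T' y))"

definition coisometry :: "('a::complex_inner \<Rightarrow> 'a) \<Rightarrow> bool" where
  "coisometry W \<longleftrightarrow> (\<exists>W'. adjoint_on UNIV W W' \<and> (\<forall>y. W (W' y) = y))"

definition unitary_on :: "'a::complex_inner set \<Rightarrow> ('a \<Rightarrow> 'a) \<Rightarrow> bool" where
  "unitary_on H U \<longleftrightarrow> (\<exists>U'. adjoint_on H U U' \<and> (\<forall>x\<in>H. U (U' x) = x \<and> U' (U x) = x))"

definition extends_on :: "'a set \<Rightarrow> ('a \<Rightarrow> 'b) \<Rightarrow> ('a \<Rightarrow> 'b) \<Rightarrow> bool" where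
  "extends_on H S T \<longleftrightarrow> (\<forall>h\<in>H. S h = T h)"

definition reduces :: "'a::complex_inner set \<Rightarrow> ('a \<Rightarrow> 'a) \<Rightarrow> bool" where
  "reduces H A \<longleftrightarrow> A ` H \<subseteq> H \<and> A ` orth H \<subseteq> orth H"

end

theory Submission
  imports Defs
begin

text \<open>
  All three parts reduce to one statement: if \<open>A\<close> is a contraction on \<open>K1\<close> leaving \<open>H1\<close>
  invariant, \<open>W\<close> is a co-isometry on \<open>K2\<close> and \<open>X A = W X\<close> on \<open>H1\<close>, then \<open>X\<close> has an extension
  \<open>Y\<close> of the same norm with \<open>Y A = W Y\<close>. Parts (i) and (ii) take \<open>A = W1 Qb\<close> and
  \<open>A = Qb W1\<close>; part (iii) takes \<open>A = W1\<close> and the co-isometry \<open>W = Qb\<^sup>* W2\<close>.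

  Starting from any norm-preserving extension \<open>Y 0\<close> of \<open>X\<close>, one finds successively
  norm-preserving extensions with \<open>W (Y (n + 1)) = (Y n) A\<close>: since \<open>W\<close> is co-isometric, such a
  \<open>Y (n + 1)\<close> is \<open>W\<^sup>* (Y n) A\<close> plus an operator into the kernel of \<open>W\<close> that is prescribed on
  \<open>H1\<close> and must be dominated by a positive semidefinite form, and such operators extend by
  projecting onto \<open>H1\<close> with respect to that form. Taking a Banach limit of the \<open>Y n\<close> in the weak
  operator sense turns the recursion into \<open>W Y = Y A\<close>.
\<close>

section \<open>Banach limits\<close>

text \<open>Tychonoff places all \<open>G N\<close> in one compact box of functions. The index type
  may be uncountable, so a convergent subsequence need not exist; convergence is along a filter
  \<open>F\<close> finer than \<open>sequentially\<close> instead.\<close>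

lemma product_cluster_point:
  fixes G :: "nat \<Rightarrow> 'i \<Rightarrow> real"
  assumes "\<And>N i. \<bar>G N i\<bar> \<le> b i"
  obtains L F where "F \<noteq> bot" "F \<le> sequentially" "\<And>i. ((\<lambda>N. G N i) \<longlongrightarrow> L i) F"
proof -
  define U where "U = (PiE UNIV (\<lambda>i. {- b i .. b i}))"
  have "compactin (product_topology (\<lambda>i::'i. euclidean::real topology) UNIV) U"
    unfolding U_def by (subst compactin_PiE) auto
  then have "compact U"
    by (simp add: euclidean_product_topology)
  moreover have "filtermap G sequentially \<noteq> bot"
    by (simp add: filtermap_bot_iff)
  moreover have "eventually (\<lambda>x. x \<in> U) (filtermap G sequentially)"
    using assms by (auto simp: eventually_filtermap U_def abs_le_iff minus_le_iff intro!: always_eventually)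
  ultimately obtain L where L: "inf (nhds L) (filtermap G sequentially) \<noteq> bot"
    unfolding compact_filter by blast
  \<comment> \<open>\<open>F\<close> collects late indices at which \<open>G\<close> is near
    \<open>L\<close>; it is proper because \<open>L\<close> is a cluster point.\<close>
  define F where "F = inf (filtercomap G (nhds L)) sequentially"
  have "F \<noteq> bot"
  proof
    assume "F = bot"
    then obtain P Q where P: "eventually P (filtercomap G (nhds L))" and Q: "eventually Q sequentially"
      and PQ: "\<And>x. P x \<Longrightarrow> Q x \<Longrightarrow> False"
      unfolding F_def trivial_limit_def eventually_inf by blast
    from P obtain R where R: "eventually R (nhds L)" "\<And>n. R (G n) \<Longrightarrow> P n"
      unfolding eventually_filtercomap by blast
    have "eventually (\<lambda>x. \<not> R x) (filtermap G sequentially)"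
      unfolding eventually_filtermap by (rule eventually_mono[OF Q]) (use R PQ in blast)
    with R(1) have "eventually (\<lambda>x. False) (inf (nhds L) (filtermap G sequentially))"
      unfolding eventually_inf by blast
    with L show False by (simp add: trivial_limit_def)
  qed
  moreover have "F \<le> sequentially" by (simp add: F_def)
  moreover have "((\<lambda>N. G N i) \<longlongrightarrow> L i) F" for i
  proof -
    have "filterlim G (nhds L) F"
      unfolding F_def filterlim_iff_le_filtercomap by simp
    moreover have "((\<lambda>x. x i) \<longlongrightarrow> L i) (nhds L)"
    proof (rule topological_tendstoI)
      fix V assume "open V" "L i \<in> V"
      moreover have "open ((\<lambda>x::'i \<Rightarrow> real. x i) -` V)"
        using \<open>open V\<close> by (rule open_vimage) simp
      ultimately show "\<forall>\<^sub>F x in nhds L. x i \<in> V"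
        unfolding eventually_nhds by (intro exI[of _ "(\<lambda>x. x i) -` V"]) auto
    qed
    ultimately show ?thesis by (rule filterlim_compose[rotated])
  qed
  ultimately show ?thesis by (rule that)
qed

text \<open>The limit is a cluster point of the Cesaro means.\<close>
lemma banach_limit_exists:
  obtains L :: "(nat \<Rightarrow> real) \<Rightarrow> real" where
    "\<And>a b. bounded (range a) \<Longrightarrow> bounded (range b) \<Longrightarrow> L (\<lambda>n. a n + b n) = L a + L b"
    "\<And>a c. bounded (range a) \<Longrightarrow> L (\<lambda>n. c * a n) = c * L a"
    "\<And>a. bounded (range a) \<Longrightarrow> L (\<lambda>n. a (Suc n)) = L a"
    "\<And>a C. (\<And>n. \<bar>a n\<bar> \<le> C) \<Longrightarrow> \<bar>L a\<bar> \<le> C"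
    "\<And>c. L (\<lambda>n. c) = c"
proof -
  \<comment> \<open>The index set consists of all real sequences; the default 0 on unbounded ones
    keeps every coordinate bounded. The sum up to \<open>N\<close> has \<open>Suc N\<close>
    terms.\<close>
  define G where "G N a = (if bounded (range a) then (\<Sum>n\<le>N. a n) / real (Suc N) else 0)"
    for N and a :: "nat \<Rightarrow> real"
  have mean_le: "\<bar>G N a\<bar> \<le> C" if C: "\<And>n. \<bar>a n\<bar> \<le> C" for N a C
  proof -
    have "bounded (range a)" using C by (auto simp: bounded_iff)
    moreover have "\<bar>\<Sum>n\<le>N. a n\<bar> \<le> (\<Sum>n\<le>N. C)"
      by (rule order_trans[OF sum_abs]) (rule sum_mono[OF C])
    ultimately show ?thesis by (simp add: G_def field_simps)
  qed
  define b where "b a = (if bounded (range a) then SOME C. \<forall>n. \<bar>a n\<bar> \<le> C else 0)" for a :: "nat \<Rightarrow> real"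
  have "\<bar>G N a\<bar> \<le> b a" for N a
  proof (cases "bounded (range a)")
    case True
    then have "\<exists>C. \<forall>n. \<bar>a n\<bar> \<le> C" by (auto simp: bounded_iff)
    from someI_ex[OF this] True show ?thesis by (intro mean_le) (simp add: b_def)
  qed (simp add: G_def b_def)
  then obtain L F where F: "F \<noteq> bot" "F \<le> sequentially" and L: "\<And>a. ((\<lambda>N. G N a) \<longlongrightarrow> L a) F"
    by (rule product_cluster_point[of G b]) blast
  show ?thesis
  proof (rule that)
    fix a b :: "nat \<Rightarrow> real" assume ab: "bounded (range a)" "bounded (range b)"
    have "bounded (range (\<lambda>n. a n + b n))" using bounded_plus_comp[OF ab] by simp
    with ab have "(\<lambda>N. G N (\<lambda>n. a n + b n)) = (\<lambda>N. G N a + G N b)"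
      by (simp add: G_def sum.distrib add_divide_distrib)
    then show "L (\<lambda>n. a n + b n) = L a + L b"
      using tendsto_unique[OF F(1)] L tendsto_add[OF L L] by metis
  next
    fix a :: "nat \<Rightarrow> real" and c assume a: "bounded (range a)"
    have "bounded (range (\<lambda>n. c * a n))" using bounded_scaling[OF a, of c] by (simp add: image_image)
    with a have "(\<lambda>N. G N (\<lambda>n. c * a n)) = (\<lambda>N. c * G N a)"
      by (simp add: G_def sum_distrib_left)
    then show "L (\<lambda>n. c * a n) = c * L a"
      using tendsto_unique[OF F(1)] L tendsto_mult_left[OF L] by metis
  next
    fix a :: "nat \<Rightarrow> real" assume a: "bounded (range a)"
    then obtain C where C: "\<And>n. \<bar>a n\<bar> \<le> C" by (auto simp: bounded_iff)
    have a': "bounded (range (\<lambda>n. a (Suc n)))" by (rule bounded_subset[OF a]) auto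
    \<comment> \<open>Shifting changes the sum only by its end terms, and division by
      \<open>Suc N\<close> makes that difference vanish in the limit.\<close>
    have "G N (\<lambda>n. a (Suc n)) - G N a = (a (Suc N) - a 0) / real (Suc N)" for N
    proof -
      have "(\<Sum>n\<le>N. a (Suc n)) - (\<Sum>n\<le>N. a n) = a (Suc N) - a 0"
        by (simp add: sum_subtractf[symmetric] sum_lessThan_telescope lessThan_Suc_atMost[symmetric] del: sum.lessThan_Suc)
      then show ?thesis using a a' by (simp add: G_def diff_divide_distrib[symmetric])
    qed
    moreover have "\<bar>a (Suc N) - a 0\<bar> \<le> 2 * C" for N using C[of "Suc N"] C[of 0] by linarith
    ultimately have le: "norm (G N (\<lambda>n. a (Suc n)) - G N a) \<le> 2 * C * inverse (real (Suc N))" for N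
      by (simp add: divide_inverse abs_mult mult_right_mono)
    have lim: "(\<lambda>N. 2 * C * inverse (real (Suc N))) \<longlonglongrightarrow> 0"
      using tendsto_mult_left[OF LIMSEQ_inverse_real_of_nat, of "2 * C"] by simp
    have "(\<lambda>N. G N (\<lambda>n. a (Suc n)) - G N a) \<longlonglongrightarrow> 0"
      by (rule Lim_null_comparison[OF always_eventually[OF allI[OF le]] lim])
    then have "((\<lambda>N. G N (\<lambda>n. a (Suc n)) - G N a) \<longlongrightarrow> 0) F"
      by (rule tendsto_mono[OF F(2)])
    from tendsto_unique[OF F(1) this tendsto_diff[OF L L]]
    show "L (\<lambda>n. a (Suc n)) = L a" by simp
  next
    fix a :: "nat \<Rightarrow> real" and C assume "\<And>n. \<bar>a n\<bar> \<le> C"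
    then show "\<bar>L a\<bar> \<le> C"
      by (intro tendsto_upperbound[OF tendsto_rabs[OF L] always_eventually[OF allI] F(1)] mean_le)
  next
    fix c :: real
    have "(\<lambda>N. G N (\<lambda>n. c)) = (\<lambda>N. c)" by (simp add: G_def fun_eq_iff)
    then show "L (\<lambda>n. c) = c" using tendsto_unique[OF F(1) L, of "\<lambda>n. c" c] by simp
  qed
qed

section \<open>Positive semidefinite forms\<close>

text \<open>Evaluate at the minimiser \<open>- b / c\<close>. The case \<open>c = 0\<close> arises
  from degenerate forms; there an affine function bounded below must be constant.\<close>

lemma quadratic_nonneg_imp_discriminant:
  fixes a b c :: real
  assumes nonneg: "\<And>t. 0 \<le> a + 2 * t * b + t\<^sup>2 * c" and "0 \<le> c"
  shows "b\<^sup>2 \<le> a * c"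
proof (cases "c = 0")
  case True
  have "b = 0"
  proof (rule ccontr)
    assume "b \<noteq> 0"
    with nonneg[of "- (a + 1) / (2 * b)"] True show False by (simp add: field_simps)
  qed
  with True show ?thesis by simp
next
  case False
  with \<open>0 \<le> c\<close> have "0 < c" by simp
  have "0 \<le> (a + 2 * (- b / c) * b + (- b / c)\<^sup>2 * c) * c"
    using nonneg \<open>0 \<le> c\<close> by (intro mult_nonneg_nonneg)
  also have "\<dots> = a * c - b\<^sup>2" using \<open>0 < c\<close> by (simp add: field_simps power2_eq_square)
  finally show ?thesis by simp
qed

section \<open>Complex subspaces and complex-linear maps\<close>

lemma scaleC_minus_one: "(-1) *\<^sub>C x = - (x::'a::complex_vector)"
  using scaleR_scaleC[of "-1" x] by simp

lemma scaleC_diff_right: "c *\<^sub>C (x - y) = c *\<^sub>C x - c *\<^sub>C (y::'a::complex_vector)"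
  using scaleC_add_right[of c "x - y" y] by (simp add: algebra_simps)

definition csubspace :: "'a::complex_vector set \<Rightarrow> bool" where
  "csubspace S \<longleftrightarrow> 0 \<in> S \<and> (\<forall>x\<in>S. \<forall>y\<in>S. x + y \<in> S) \<and> (\<forall>c. \<forall>x\<in>S. c *\<^sub>C x \<in> S)"

lemma csubspaceD:
  assumes "csubspace S"
  shows "0 \<in> S" "x \<in> S \<Longrightarrow> y \<in> S \<Longrightarrow> x + y \<in> S" "x \<in> S \<Longrightarrow> c *\<^sub>C x \<in> S"
    "x \<in> S \<Longrightarrow> y \<in> S \<Longrightarrow> x - y \<in> S" "x \<in> S \<Longrightarrow> r *\<^sub>R x \<in> S"
proof -
  show add: "x \<in> S \<Longrightarrow> y \<in> S \<Longrightarrow> x + y \<in> S" and scale: "x \<in> S \<Longrightarrow> c *\<^sub>C x \<in> S" and "0 \<in> S" for x y c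
    using assms by (auto simp: csubspace_def)
  show "x \<in> S \<Longrightarrow> y \<in> S \<Longrightarrow> x - y \<in> S"
    using add[of x "- y"] scale[of y "-1"] by (simp add: scaleC_minus_one)
  show "x \<in> S \<Longrightarrow> r *\<^sub>R x \<in> S" by (simp add: scaleR_scaleC scale)
qed

definition clinear_on :: "'a::complex_vector set \<Rightarrow> ('a \<Rightarrow> 'b::complex_vector) \<Rightarrow> bool" where
  "clinear_on S f \<longleftrightarrow> (\<forall>x\<in>S. \<forall>y\<in>S. f (x + y) = f x + f y) \<and> (\<forall>c. \<forall>x\<in>S. f (c *\<^sub>C x) = c *\<^sub>C f x)"

lemma clinear_onD:
  assumes "clinear_on S f"
  shows "x \<in> S \<Longrightarrow> y \<in> S \<Longrightarrow> f (x + y) = f x + f y" "x \<in> S \<Longrightarrow> f (c *\<^sub>C x) = c *\<^sub>C f x"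
    "x \<in> S \<Longrightarrow> f (r *\<^sub>R x) = r *\<^sub>R f x"
    "csubspace S \<Longrightarrow> x \<in> S \<Longrightarrow> y \<in> S \<Longrightarrow> f (x - y) = f x - f y"
proof -
  show add: "x \<in> S \<Longrightarrow> y \<in> S \<Longrightarrow> f (x + y) = f x + f y"
    and scale: "x \<in> S \<Longrightarrow> f (c *\<^sub>C x) = c *\<^sub>C f x" for x y c
    using assms by (auto simp: clinear_on_def)
  show "x \<in> S \<Longrightarrow> f (r *\<^sub>R x) = r *\<^sub>R f x" by (simp add: scaleR_scaleC scale)
  show "csubspace S \<Longrightarrow> x \<in> S \<Longrightarrow> y \<in> S \<Longrightarrow> f (x - y) = f x - f y"
    using add[of "x - y" y] csubspaceD(4)[of S x y] by (simp add: algebra_simps)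
qed

lemma Cauchy_if_null_bound:
  fixes z :: "nat \<Rightarrow> 'b::real_normed_vector"
  assumes e: "e \<longlonglongrightarrow> (0::real)" and le: "\<And>m n. norm (z m - z n) \<le> e m + e n"
  shows "Cauchy z"
proof (rule metric_CauchyI)
  fix d :: real assume "0 < d"
  then obtain M where "\<And>n. M \<le> n \<Longrightarrow> norm (e n - 0) < d / 2"
    using LIMSEQ_D[OF e, of "d / 2"] by auto
  then have "norm (z m - z n) < d" if "M \<le> m" "M \<le> n" for m n
    using le[of m n] that by (smt (verit) field_sum_of_halves real_norm_def diff_zero)
  then show "\<exists>M. \<forall>m\<ge>M. \<forall>n\<ge>M. dist (z m) (z n) < d"
    by (auto simp: dist_norm)
qed

text \<open>The real part of a positive semidefinite Hermitian form; \<open>form_scaleC\<close> retains its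
  compatibility with the complex structure.\<close>
locale semi_form =
  fixes B :: "'a::complex_vector \<Rightarrow> 'a \<Rightarrow> real"
  assumes form_sym: "B x y = B y x"
    and form_add: "B (x + y) z = B x z + B y z"
    and form_scaleR: "B (r *\<^sub>R x) y = r * B x y"
    and form_scaleC: "B (c *\<^sub>C x) y = B x (cnj c *\<^sub>C y)"
    and form_nonneg: "0 \<le> B x x"
begin

definition seminorm :: "'a \<Rightarrow> real" where
  "seminorm x = sqrt (B x x)"

lemma seminorm_nonneg: "0 \<le> seminorm x"
  and seminorm_power2: "(seminorm x)\<^sup>2 = B x x"
  by (simp_all add: seminorm_def form_nonneg)

lemma form_diff: "B (x - y) z = B x z - B y z"
  using form_add[of "x - y" y z] by simp

lemma form_add_right: "B x (y + z) = B x y + B x z"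
  and form_diff_right: "B x (y - z) = B x y - B x z"
  and form_scaleR_right: "B x (r *\<^sub>R y) = r * B x y"
  using form_add[of y z x] form_diff[of y z x] form_scaleR[of r y x] by (simp_all add: form_sym)

lemma form_Cauchy_Schwarz: "\<bar>B x y\<bar> \<le> seminorm x * seminorm y"
proof -
  have "0 \<le> B x x + 2 * t * B x y + t\<^sup>2 * B y y" for t
    using form_nonneg[of "x + t *\<^sub>R y"] form_sym[of y x]
    by (simp add: form_add form_add_right form_scaleR form_scaleR_right power2_eq_square algebra_simps)
  then have "(B x y)\<^sup>2 \<le> B x x * B y y"
    by (rule quadratic_nonneg_imp_discriminant) (rule form_nonneg)
  then show ?thesis
    unfolding seminorm_def real_sqrt_mult[symmetric] by (simp add: real_le_rsqrt)
qed

text \<open>Moving \<open>c\<close> across the form leaves the factor \<open>cnj c * c\<close>,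
  which is real, so real homogeneity of \<open>B\<close> finishes the computation.\<close>

lemma seminorm_scaleC: "seminorm (c *\<^sub>C x) = cmod c * seminorm x"
proof -
  have "B (c *\<^sub>C x) (c *\<^sub>C x) = B x ((cnj c * c) *\<^sub>C x)" by (simp add: form_scaleC scaleC_scaleC)
  also have "cnj c * c = complex_of_real ((cmod c)\<^sup>2)" by (simp add: mult.commute flip: complex_norm_square)
  finally have "B (c *\<^sub>C x) (c *\<^sub>C x) = (cmod c)\<^sup>2 * B x x"
    by (simp only: scaleR_scaleC[symmetric] form_scaleR_right)
  then show ?thesis by (simp add: seminorm_def real_sqrt_mult)
qed

text \<open>Riesz representation without completeness: near-minimisers of \<open>B h h - 2 \<phi> h\<close>
  represent \<open>\<phi>\<close> up to a small error.\<close>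
lemma approximate_riesz:
  assumes S: "csubspace S"
    and add: "\<And>x y. x \<in> S \<Longrightarrow> y \<in> S \<Longrightarrow> \<phi> (x + y) = \<phi> x + \<phi> y"
    and scale: "\<And>r x. x \<in> S \<Longrightarrow> \<phi> (r *\<^sub>R x) = r * \<phi> x"
    and bound: "\<And>x. x \<in> S \<Longrightarrow> \<bar>\<phi> x\<bar> \<le> C * seminorm x"
    and "0 < e"
  obtains x where "x \<in> S" "\<And>h. h \<in> S \<Longrightarrow> \<bar>B x h - \<phi> h\<bar> \<le> e * seminorm h"
proof -
  define J where "J h = B h h - 2 * \<phi> h" for h
  have "- C\<^sup>2 \<le> J h" if "h \<in> S" for h
  proof -
    have "0 \<le> (seminorm h - C)\<^sup>2" by simp
    then show ?thesis using bound[OF that] seminorm_power2[of h]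
      by (simp add: J_def power2_diff algebra_simps)
  qed
  then have bdd: "bdd_below (J ` S)" by (auto simp: bdd_below_def)
  have "J ` S \<noteq> {}" using csubspaceD(1)[OF S] by auto
  \<comment> \<open>The slack is \<open>e\<^sup>2\<close> because it becomes the constant term of
    the quadratic in \<open>t\<close> below; its discriminant bound then has a square root linear in
    \<open>e\<close>.\<close>
  then obtain x where x: "x \<in> S" "J x < Inf (J ` S) + e\<^sup>2"
    using cInf_lessD[of "J ` S" "Inf (J ` S) + e\<^sup>2"] \<open>0 < e\<close> by auto
  show ?thesis
  proof (rule that[OF x(1)])
    fix h assume h: "h \<in> S"
    have "0 \<le> e\<^sup>2 + 2 * t * (B x h - \<phi> h) + t\<^sup>2 * B h h" for t
    proof -
      have "x + t *\<^sub>R h \<in> S" by (simp add: S csubspaceD h x)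
      then have "Inf (J ` S) \<le> J (x + t *\<^sub>R h)" using bdd by (simp add: cINF_lower)
      also have "\<dots> = J x + 2 * t * (B x h - \<phi> h) + t\<^sup>2 * B h h"
        using h x form_sym[of h x] csubspaceD(5)[OF S h]
        by (simp add: J_def add scale form_add form_add_right form_scaleR form_scaleR_right
            power2_eq_square algebra_simps)
      finally show ?thesis using x(2) by simp
    qed
    then have "(B x h - \<phi> h)\<^sup>2 \<le> e\<^sup>2 * B h h"
      by (rule quadratic_nonneg_imp_discriminant) (rule form_nonneg)
    also have "\<dots> = (e * seminorm h)\<^sup>2" by (simp add: power_mult_distrib seminorm_power2)
    finally show "\<bar>B x h - \<phi> h\<bar> \<le> e * seminorm h"
      using \<open>0 < e\<close> seminorm_nonneg[of h] by (simp add: abs_le_square_iff[symmetric] abs_mult)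
  qed
qed

text \<open>The sequence \<open>x\<close> stands in for the \<open>B\<close>-orthogonal projection
  of \<open>k\<close> onto \<open>S\<close>: the defect \<open>k - x n\<close> becomes orthogonal to
  \<open>S\<close>, uniformly on vectors of bounded seminorm. A sequence is used because
  \<open>B\<close> may be degenerate and \<open>S\<close> incomplete for its seminorm.\<close>

definition projects :: "'a set \<Rightarrow> 'a \<Rightarrow> (nat \<Rightarrow> 'a) \<Rightarrow> bool" where
  "projects S k x \<longleftrightarrow> (\<forall>n. x n \<in> S) \<and>
     (\<exists>e. e \<longlonglongrightarrow> 0 \<and> (\<forall>n. \<forall>h\<in>S. \<bar>B (k - x n) h\<bar> \<le> e n * seminorm h))"

lemma projects_exists:
  assumes S: "csubspace S"
  shows "\<exists>x. projects S k x"
proof -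
  have "\<exists>x. x \<in> S \<and> (\<forall>h\<in>S. \<bar>B (k - x) h\<bar> \<le> inverse (real (Suc n)) * seminorm h)" for n
  proof -
    have "\<exists>x. x \<in> S \<and> (\<forall>h\<in>S. \<bar>B x h - B k h\<bar> \<le> inverse (real (Suc n)) * seminorm h)"
      by (rule approximate_riesz[OF S, of "B k" "seminorm k"])
        (auto simp: form_add_right form_scaleR_right form_Cauchy_Schwarz)
    then show ?thesis by (simp add: form_diff abs_minus_commute)
  qed
  then obtain x where "\<And>n. x n \<in> S" "\<And>n h. h \<in> S \<Longrightarrow> \<bar>B (k - x n) h\<bar> \<le> inverse (real (Suc n)) * seminorm h"
    by metis
  then show ?thesis unfolding projects_def
    using LIMSEQ_inverse_real_of_nat by blast
qed

lemma projects_const: "k \<in> S \<Longrightarrow> projects S k (\<lambda>n. k)"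
  unfolding projects_def using tendsto_const[of "0::real"] form_diff[of k k]
  by (intro conjI exI[of _ "\<lambda>n. 0"]) auto

lemma projects_add:
  assumes S: "csubspace S" and "projects S k x" "projects S l y"
  shows "projects S (k + l) (\<lambda>n. x n + y n)"
proof -
  from assms obtain d e where xy: "\<And>n. x n \<in> S" "\<And>n. y n \<in> S" and lim: "d \<longlonglongrightarrow> 0" "e \<longlonglongrightarrow> 0"
    and d: "\<And>n h. h \<in> S \<Longrightarrow> \<bar>B (k - x n) h\<bar> \<le> d n * seminorm h"
    and e: "\<And>n h. h \<in> S \<Longrightarrow> \<bar>B (l - y n) h\<bar> \<le> e n * seminorm h"
    unfolding projects_def by blast
  have "\<bar>B (k + l - (x n + y n)) h\<bar> \<le> (d n + e n) * seminorm h" if "h \<in> S" for n h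
    using d[OF that, of n] e[OF that, of n]
    by (simp add: form_add form_diff algebra_simps)
  moreover have "(\<lambda>n. d n + e n) \<longlonglongrightarrow> 0" using tendsto_add[OF lim] by simp
  ultimately show ?thesis unfolding projects_def
    using csubspaceD(2)[OF S] xy by blast
qed

text \<open>The scalar moves to the test vector as its conjugate, which stays in \<open>S\<close>;
  the error grows by the factor \<open>cmod c\<close>.\<close>

lemma projects_scaleC:
  assumes S: "csubspace S" and "projects S k x"
  shows "projects S (c *\<^sub>C k) (\<lambda>n. c *\<^sub>C x n)"
proof -
  from assms obtain e where x: "\<And>n. x n \<in> S" and lim: "e \<longlonglongrightarrow> 0"
    and e: "\<And>n h. h \<in> S \<Longrightarrow> \<bar>B (k - x n) h\<bar> \<le> e n * seminorm h"
    unfolding projects_def by blast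
  have "\<bar>B (c *\<^sub>C k - c *\<^sub>C x n) h\<bar> \<le> (cmod c * e n) * seminorm h" if "h \<in> S" for n h
    using e[OF csubspaceD(3)[OF S that], of n "cnj c"]
    by (simp add: scaleC_diff_right[symmetric] form_scaleC seminorm_scaleC mult_ac)
  moreover have "(\<lambda>n. cmod c * e n) \<longlonglongrightarrow> 0" using tendsto_mult_left[OF lim, of "cmod c"] by simp
  ultimately show ?thesis unfolding projects_def
    using csubspaceD(3)[OF S] x by blast
qed

lemma projects_diff:
  assumes S: "csubspace S" and "projects S k x" "projects S l y"
  shows "projects S (k - l) (\<lambda>n. x n - y n)"
  using projects_add[OF S assms(2) projects_scaleC[OF S assms(3), of "-1"]]
  by (simp add: scaleC_minus_one)

text \<open>Approximate form of the fact that projections do not increase length: the defect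
  \<open>k - x n\<close> is tested against \<open>x n\<close> itself.\<close>

lemma projects_seminorm_le:
  assumes "projects S k x"
  obtains e where "e \<longlonglongrightarrow> 0" "\<And>n. seminorm (x n) \<le> seminorm k + e n"
proof -
  from assms obtain e where x: "\<And>n. x n \<in> S" and lim: "e \<longlonglongrightarrow> 0"
    and e: "\<And>n h. h \<in> S \<Longrightarrow> \<bar>B (k - x n) h\<bar> \<le> e n * seminorm h"
    unfolding projects_def by blast
  have "seminorm (x n) \<le> seminorm k + \<bar>e n\<bar>" for n
  proof (cases "seminorm (x n) = 0")
    case False
    then have pos: "0 < seminorm (x n)" using seminorm_nonneg[of "x n"] by simp
    have "(seminorm (x n))\<^sup>2 = B k (x n) - B (k - x n) (x n)"
      by (simp add: seminorm_power2 form_diff)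
    also have "\<dots> \<le> seminorm k * seminorm (x n) + e n * seminorm (x n)"
      using form_Cauchy_Schwarz[of k "x n"] e[OF x[of n], of n] by linarith
    finally have "seminorm (x n) * seminorm (x n) \<le> (seminorm k + e n) * seminorm (x n)"
      by (simp add: power2_eq_square algebra_simps)
    then have "seminorm (x n) \<le> seminorm k + e n" using pos by simp
    then show ?thesis by simp
  qed (simp add: seminorm_nonneg)
  moreover have "(\<lambda>n. \<bar>e n\<bar>) \<longlonglongrightarrow> 0" using tendsto_rabs[OF lim] by simp
  ultimately show ?thesis by (rule that[rotated])
qed

text \<open>The defects at \<open>m\<close> and at \<open>n\<close> are both tested against the
  difference \<open>x m - x n\<close>.\<close>

lemma projects_seminorm_Cauchy:
  assumes S: "csubspace S" and "projects S k x"
  obtains e where "e \<longlonglongrightarrow> 0" "\<And>m n. seminorm (x m - x n) \<le> e m + e n"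
proof -
  from assms obtain e where x: "\<And>n. x n \<in> S" and lim: "e \<longlonglongrightarrow> 0"
    and e: "\<And>n h. h \<in> S \<Longrightarrow> \<bar>B (k - x n) h\<bar> \<le> e n * seminorm h"
    unfolding projects_def by blast
  have "seminorm (x m - x n) \<le> \<bar>e m\<bar> + \<bar>e n\<bar>" for m n
  proof (cases "seminorm (x m - x n) = 0")
    case False
    define u where "u = x m - x n"
    have u: "u \<in> S" by (simp add: u_def S csubspaceD x)
    have pos: "0 < seminorm u" using False seminorm_nonneg[of u] by (simp add: u_def)
    have "(seminorm u)\<^sup>2 = B (k - x n) u - B (k - x m) u"
      by (simp add: seminorm_power2 u_def form_diff)
    also have "\<dots> \<le> e m * seminorm u + e n * seminorm u"
      using e[OF u, of m] e[OF u, of n] by linarith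
    finally have "seminorm u * seminorm u \<le> (e m + e n) * seminorm u"
      by (simp add: power2_eq_square algebra_simps)
    then have "seminorm u \<le> e m + e n" using pos by simp
    then show ?thesis by (simp add: u_def)
  qed simp
  moreover have "(\<lambda>n. \<bar>e n\<bar>) \<longlonglongrightarrow> 0" using tendsto_rabs[OF lim] by simp
  ultimately show ?thesis by (rule that[rotated])
qed

end

section \<open>The real inner product of a complex inner product space\<close>

text \<open>With the real part, limits of inner products can be taken by a real Banach limit;
  complex homogeneity is recovered by letting scalars act on the test vector.\<close>

definition ip :: "'a::complex_inner \<Rightarrow> 'a \<Rightarrow> real" where
  "ip x y = Re (cinner x y)"

lemma ip_sym: "ip x y = ip y x"
  unfolding ip_def by (subst cinner_commute) simp

lemma norm_power2_eq_ip: "(norm x)\<^sup>2 = ip x x"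
  by (simp add: norm_eq_sqrt_cinner ip_def cinner_Re_nonneg)

lemma semi_form_ip: "semi_form (ip :: 'a::complex_inner \<Rightarrow> 'a \<Rightarrow> real)"
proof
  fix x y z :: 'a and r :: real and c :: complex
  show "ip x y = ip y x" by (rule ip_sym)
  show "ip (x + y) z = ip x z + ip y z" by (simp add: ip_def cinner_add_left)
  show "ip (r *\<^sub>R x) y = r * ip x y" by (simp add: ip_def cinner_scaleC_left scaleR_scaleC)
  \<comment> \<open>\<open>cinner\<close> is conjugate-linear on the left and linear on the right,
    so both sides produce the factor \<open>cnj c\<close>.\<close>
  have "cinner x (cnj c *\<^sub>C y) = cnj c * cinner x y"
    by (subst (1 2) cinner_commute) (simp add: cinner_scaleC_left)
  then show "ip (c *\<^sub>C x) y = ip x (cnj c *\<^sub>C y)" 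
    by (simp add: ip_def cinner_scaleC_left)
  show "0 \<le> ip x x" by (simp add: ip_def cinner_Re_nonneg)
qed

interpretation ip: semi_form ip
  by (rule semi_form_ip)

lemma ip_seminorm: "ip.seminorm x = norm x"
  by (simp add: ip.seminorm_def norm_power2_eq_ip[symmetric])

lemma norm_scaleC: "norm (c *\<^sub>C x) = cmod c * norm (x::'a::complex_inner)"
  using ip.seminorm_scaleC[of c x] by (simp add: ip_seminorm)

lemma tendsto_scaleC:
  fixes f :: "nat \<Rightarrow> 'a::complex_inner"
  assumes "f \<longlonglongrightarrow> x"
  shows "(\<lambda>n. c *\<^sub>C f n) \<longlonglongrightarrow> c *\<^sub>C x"
proof -
  have "(\<lambda>n. norm (c *\<^sub>C f n - c *\<^sub>C x)) \<longlonglongrightarrow> 0"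
    using tendsto_mult_left[OF tendsto_norm_zero[OF LIM_zero[OF assms]], of "cmod c"]
    by (simp add: norm_scaleC flip: scaleC_diff_right)
  then show ?thesis using LIM_zero_iff tendsto_norm_zero_iff by blast
qed

context semi_form
begin

text \<open>\<open>Z'\<close> is \<open>Z\<close> composed with the \<open>B\<close>-orthogonal projection onto \<open>S\<close>. The projection itself need
  not exist, but completeness of the codomain makes the composition meaningful.\<close>
lemma extend_dominated:
  fixes Z :: "'a \<Rightarrow> 'b::chilbert_space"
  assumes S: "csubspace S" and Z: "clinear_on S Z" and dom: "\<And>h. h \<in> S \<Longrightarrow> norm (Z h) \<le> seminorm h"
  obtains Z' where "clinear_on UNIV Z'" "\<And>h. h \<in> S \<Longrightarrow> Z' h = Z h" "\<And>k. norm (Z' k) \<le> seminorm k"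
proof -
  obtain x where x: "\<And>k. projects S k (x k)" using projects_exists[OF S] by metis
  have in_S: "y n \<in> S" if "projects S k y" for k y n
    using that by (simp add: projects_def)
  \<comment> \<open>Approximate projections of 0 have vanishing seminorm, and domination carries
    this over to \<open>Z\<close>.\<close>
  have null: "(\<lambda>n. Z (y n)) \<longlonglongrightarrow> 0" if y: "projects S 0 y" for y
  proof -
    obtain e where "e \<longlonglongrightarrow> 0" and e: "\<And>n. seminorm (y n) \<le> seminorm 0 + e n"
      by (rule projects_seminorm_le[OF y]) blast
    moreover have "seminorm 0 = 0" using form_diff[of 0 0 0] by (simp add: seminorm_def)
    ultimately have "norm (Z (y n)) \<le> e n" for n
      using dom[OF in_S[OF y], of n] e[of n] by linarith
    then show ?thesis
      by (intro Lim_null_comparison[OF always_eventually \<open>e \<longlonglongrightarrow> 0\<close>]) simp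
  qed
  have "convergent (\<lambda>n. Z (x k n))" for k
  proof -
    obtain e where lim: "e \<longlonglongrightarrow> 0" and e: "\<And>m n. seminorm (x k m - x k n) \<le> e m + e n"
      by (rule projects_seminorm_Cauchy[OF S x[of k]]) blast
    have "norm (Z (x k m) - Z (x k n)) \<le> e m + e n" for m n
      using dom[OF csubspaceD(4)[OF S in_S[OF x] in_S[OF x]], of k m k n] e[of m n]
        clinear_onD(4)[OF Z S in_S[OF x] in_S[OF x], of k m k n]
      by simp
    from Cauchy_if_null_bound[OF lim this] show ?thesis
      by (rule Cauchy_convergent)
  qed
  then obtain Z' where Z': "\<And>k. (\<lambda>n. Z (x k n)) \<longlonglongrightarrow> Z' k"
    unfolding convergent_def by metis
  \<comment> \<open>Any approximate projection of \<open>k\<close> may compute \<open>Z' k\<close>;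
    linearity and agreement with \<open>Z\<close> follow by choosing a convenient one.\<close>
  have unique: "Z' k = z" if y: "projects S k y" and z: "(\<lambda>n. Z (y n)) \<longlonglongrightarrow> z" for k y z
  proof -
    have "projects S 0 (\<lambda>n. x k n - y n)" using projects_diff[OF S x[of k] y] by simp
    from null[OF this] have "(\<lambda>n. Z (x k n) - Z (y n)) \<longlonglongrightarrow> 0"
      by (simp add: clinear_onD(4)[OF Z S] in_S[OF x] in_S[OF y])
    from LIMSEQ_unique[OF this tendsto_diff[OF Z' z]] show ?thesis by simp
  qed
  show ?thesis
  proof (rule that)
    show "clinear_on UNIV Z'" unfolding clinear_on_def
    proof (intro conjI allI ballI)
      fix k l
      show "Z' (k + l) = Z' k + Z' l"
        by (rule unique[OF projects_add[OF S x x]])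
          (simp add: clinear_onD(1)[OF Z] in_S[OF x] tendsto_add Z')
    next
      fix c k
      have "(\<lambda>n. c *\<^sub>C Z (x k n)) \<longlonglongrightarrow> c *\<^sub>C Z' k"
        using Z'[of k] by (intro tendsto_scaleC)
      then show "Z' (c *\<^sub>C k) = c *\<^sub>C Z' k"
        by (intro unique[OF projects_scaleC[OF S x]]) (simp add: clinear_onD(2)[OF Z] in_S[OF x])
    qed
    show "Z' h = Z h" if "h \<in> S" for h
      by (rule unique[OF projects_const[OF that] tendsto_const])
    fix k
    obtain e where lim: "e \<longlonglongrightarrow> 0" and e: "\<And>n. seminorm (x k n) \<le> seminorm k + e n"
      by (rule projects_seminorm_le[OF x[of k]]) blast
    have "norm (Z (x k n)) \<le> seminorm k + e n" for n
      using dom[OF in_S[OF x]] e order_trans by blast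
    from LIMSEQ_le[OF tendsto_norm[OF Z'[of k]] tendsto_add[OF tendsto_const lim]] this
    show "norm (Z' k) \<le> seminorm k" by auto
  qed
qed

end

section \<open>Riesz representation in a Hilbert space\<close>

lemma ip_Cauchy_Schwarz: "\<bar>ip x y\<bar> \<le> norm x * norm y"
  using ip.form_Cauchy_Schwarz[of x y] by (simp add: ip_seminorm)

lemma ip_eqI:
  assumes "\<And>h. ip x h = ip y h"
  shows "x = y"
proof -
  have "(norm (x - y))\<^sup>2 = 0" by (simp add: norm_power2_eq_ip ip.form_diff assms)
  then show ?thesis by simp
qed

lemma csubspace_UNIV: "csubspace UNIV"
  by (simp add: csubspace_def)

text \<open>Approximate representatives with error \<open>inverse (real (Suc n))\<close> form a
  Cauchy sequence, as seen by testing two of them against their difference; completeness supplies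
  the limit.\<close>

lemma riesz:
  fixes \<phi> :: "'a::chilbert_space \<Rightarrow> real"
  assumes add: "\<And>x y. \<phi> (x + y) = \<phi> x + \<phi> y" and scale: "\<And>r x. \<phi> (r *\<^sub>R x) = r * \<phi> x"
    and bound: "\<And>x. \<bar>\<phi> x\<bar> \<le> C * norm x"
  shows "\<exists>y. \<forall>h. ip y h = \<phi> h"
proof -
  have "\<exists>x. \<forall>h. \<bar>ip x h - \<phi> h\<bar> \<le> inverse (real (Suc n)) * norm h" for n
    by (rule ip.approximate_riesz[OF csubspace_UNIV, of \<phi> C "inverse (real (Suc n))"])
      (auto simp: add scale bound ip_seminorm)
  then obtain x where x: "\<And>n h. \<bar>ip (x n) h - \<phi> h\<bar> \<le> inverse (real (Suc n)) * norm h"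
    by metis
  have "norm (x m - x n) \<le> inverse (real (Suc m)) + inverse (real (Suc n))" for m n
  proof (cases "x m = x n")
    case False
    define u where "u = x m - x n"
    have "norm u * norm u = ip (x m) u - ip (x n) u"
      by (simp add: norm_power2_eq_ip u_def ip.form_diff flip: power2_eq_square)
    also have "\<dots> \<le> (inverse (real (Suc m)) + inverse (real (Suc n))) * norm u"
      using x[of m u] x[of n u] unfolding distrib_right by linarith
    finally have "norm u \<le> inverse (real (Suc m)) + inverse (real (Suc n))"
      using False by (simp add: u_def del: of_nat_Suc)
    then show ?thesis by (simp add: u_def)
  qed simp
  from Cauchy_if_null_bound[OF LIMSEQ_inverse_real_of_nat this]
  obtain y where y: "x \<longlonglongrightarrow> y" using Cauchy_convergent convergent_def by blast
  have "ip y h = \<phi> h" for h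
  proof -
    have le: "norm (ip (y - x n) h) \<le> norm (y - x n) * norm h" for n
      by (simp add: ip_Cauchy_Schwarz)
    have lim: "(\<lambda>n. norm (y - x n) * norm h) \<longlonglongrightarrow> 0"
      using tendsto_mult_right[OF tendsto_norm[OF tendsto_diff[OF tendsto_const y]], of y "norm h"] by simp
    have 1: "(\<lambda>n. ip (y - x n) h) \<longlonglongrightarrow> 0"
      by (rule Lim_null_comparison[OF always_eventually[OF allI[OF le]] lim])
    have le: "norm (ip (x n) h - \<phi> h) \<le> inverse (real (Suc n)) * norm h" for n
      using x[of n h] by simp
    have lim: "(\<lambda>n. inverse (real (Suc n)) * norm h) \<longlonglongrightarrow> 0"
      using tendsto_mult_right[OF LIMSEQ_inverse_real_of_nat, of "norm h"] by simp
    have 2: "(\<lambda>n. ip (x n) h - \<phi> h) \<longlonglongrightarrow> 0"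
      by (rule Lim_null_comparison[OF always_eventually[OF allI[OF le]] lim])
    have "(\<lambda>n. ip y h - \<phi> h) \<longlonglongrightarrow> 0" using tendsto_add[OF 1 2] by (simp add: ip.form_diff)
    then show ?thesis by (simp add: LIMSEQ_const_iff)
  qed
  then show ?thesis by blast
qed

text \<open>Domination by this form is the operator bound \<open>M\<close>, so
  \<open>extend_dominated\<close> yields the first norm-preserving extension.\<close>

lemma seminorm_scaled_ip:
  fixes x :: "'a::complex_inner"
  assumes "0 \<le> M"
  shows "semi_form (\<lambda>x y :: 'a. M\<^sup>2 * ip x y)"
    and "semi_form.seminorm (\<lambda>x y. M\<^sup>2 * ip x y) x = M * norm x"
proof -
  show *: "semi_form (\<lambda>x y :: 'a. M\<^sup>2 * ip x y)"
    using ip_sym by unfold_locales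
      (auto simp: ip.form_add ip.form_scaleR ip.form_scaleC algebra_simps simp flip: norm_power2_eq_ip)
  show "semi_form.seminorm (\<lambda>x y. M\<^sup>2 * ip x y) x = M * norm x"
    using assms by (simp add: semi_form.seminorm_def[OF *] real_sqrt_mult flip: norm_power2_eq_ip)
qed

section \<open>Extensions intertwining a contraction with a co-isometry\<close>

locale coisometric_op =
  fixes W W' :: "'b::chilbert_space \<Rightarrow> 'b"
  assumes lin: "clinear_on UNIV W" and lin': "clinear_on UNIV W'"
    and adj: "ip (W x) y = ip x (W' y)" and right_inv: "W (W' y) = y"
begin

lemma norm_adj: "norm (W' y) = norm y"
proof -
  have "(norm (W' y))\<^sup>2 = (norm y)\<^sup>2"
    by (simp add: norm_power2_eq_ip adj[symmetric] right_inv)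
  then show ?thesis by simp
qed

text \<open>The orthogonal projection onto the kernel of \<open>W\<close>: \<open>W' (W x)\<close>
  is the component of \<open>x\<close> in the range of the isometry \<open>W'\<close>.\<close>

definition ker_proj :: "'b \<Rightarrow> 'b" where
  "ker_proj x = x - W' (W x)"

lemma W_ker_proj: "W (ker_proj x) = 0"
  using clinear_onD(4)[OF lin csubspace_UNIV] by (simp add: ker_proj_def right_inv)

lemma ker_proj_idem: "ker_proj (ker_proj x) = ker_proj x"
  using clinear_onD(4)[OF lin' csubspace_UNIV, of 0 0]
  by (simp add: ker_proj_def[of "ker_proj x"] W_ker_proj)

text \<open>Pythagoras for \<open>x = W' (W x) + ker_proj x\<close>, with \<open>W'\<close>
  isometric.\<close>

lemma norm_ker_proj: "(norm (ker_proj x))\<^sup>2 = (norm x)\<^sup>2 - (norm (W x))\<^sup>2"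
proof -
  have "ip x (W' (W x)) = (norm (W x))\<^sup>2" by (simp add: adj[symmetric] norm_power2_eq_ip)
  moreover have "ip (W' (W x)) (W' (W x)) = (norm (W x))\<^sup>2"
    by (simp add: norm_adj flip: norm_power2_eq_ip)
  ultimately show ?thesis
    by (simp add: ker_proj_def norm_power2_eq_ip ip.form_diff ip.form_diff_right ip_sym[of "W' (W x)" x])
qed

lemma norm_W_le: "norm (W x) \<le> norm x"
proof (rule power2_le_imp_le)
  show "(norm (W x))\<^sup>2 \<le> (norm x)\<^sup>2"
    using norm_ker_proj[of x] zero_le_power2[of "norm (ker_proj x)"] by linarith
qed simp

text \<open>The range of \<open>W'\<close> is orthogonal to the kernel of \<open>W\<close>.\<close>

lemma norm_adj_add_ker: "(norm (W' y + ker_proj x))\<^sup>2 = (norm y)\<^sup>2 + (norm (ker_proj x))\<^sup>2"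
proof -
  have "ip (W' y) (ker_proj x) = 0"
    using adj[of "ker_proj x" y] ip.form_diff[of 0 0 y] by (simp add: W_ker_proj ip_sym)
  moreover have "ip (W' y) (W' y) = ip y y" by (simp add: adj[symmetric] right_inv)
  ultimately show ?thesis
    using ip_sym[of "ker_proj x" "W' y"] by (simp add: norm_power2_eq_ip ip.form_add ip.form_add_right)
qed

lemma clinear_ker_proj: "clinear_on UNIV ker_proj"
  using lin lin' by (simp add: clinear_on_def ker_proj_def scaleC_diff_right)

text \<open>The requirement \<open>W \<circ> Y' = Y \<circ> A\<close> fixes \<open>Y'\<close> up to a component in the kernel of \<open>W\<close>.
  That component is prescribed on \<open>H\<close>, and the norm constraint says that it is dominated by the
  form \<open>M\<^sup>2 \<parallel>k\<parallel>\<^sup>2 - \<parallel>Y (A k)\<parallel>\<^sup>2\<close>.\<close>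
lemma lifting_step:
  fixes A :: "'a::complex_inner \<Rightarrow> 'a" and X Y :: "'a \<Rightarrow> 'b"
  assumes H: "csubspace H" and X: "clinear_on H X"
    and A: "clinear_on UNIV A" "\<And>k. norm (A k) \<le> norm k" "\<And>h. h \<in> H \<Longrightarrow> A h \<in> H"
    and XA: "\<And>h. h \<in> H \<Longrightarrow> X (A h) = W (X h)" and M: "0 \<le> M"
    and Y: "clinear_on UNIV Y" "\<And>k. norm (Y k) \<le> M * norm k" "\<And>h. h \<in> H \<Longrightarrow> Y h = X h"
  obtains Y' where "clinear_on UNIV Y'" "\<And>k. norm (Y' k) \<le> M * norm k"
    "\<And>h. h \<in> H \<Longrightarrow> Y' h = X h" "\<And>k. W (Y' k) = Y (A k)"
proof -
  define B where "B x y = M\<^sup>2 * ip x y - ip (Y (A x)) (Y (A y))" for x y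
  have YA: "norm (Y (A k)) \<le> M * norm k" for k
    using Y(2)[of "A k"] mult_left_mono[OF A(2)[of k] M] by linarith
  have B_eq: "B k k = (M * norm k)\<^sup>2 - (norm (Y (A k)))\<^sup>2" for k
    by (simp add: B_def power_mult_distrib norm_power2_eq_ip)
  interpret B: semi_form B
  proof
    fix x y z :: 'a and r :: real and c :: complex
    show "B x y = B y x" by (simp add: B_def ip_sym[of x] ip_sym[of "Y (A x)"])
    show "B (x + y) z = B x z + B y z"
      by (simp add: B_def clinear_onD(1)[OF A(1)] clinear_onD(1)[OF Y(1)] ip.form_add algebra_simps)
    show "B (r *\<^sub>R x) y = r * B x y"
      by (simp add: B_def clinear_onD(3)[OF A(1)] clinear_onD(3)[OF Y(1)] ip.form_scaleR algebra_simps)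
    show "B (c *\<^sub>C x) y = B x (cnj c *\<^sub>C y)"
      by (simp add: B_def clinear_onD(2)[OF A(1)] clinear_onD(2)[OF Y(1)] ip.form_scaleC)
    show "0 \<le> B x x"
      using power_mono[OF YA[of x] norm_ge_zero, of 2] by (simp add: B_eq)
  qed
  have lin_Z: "clinear_on H (\<lambda>h. ker_proj (X h))"
    using X clinear_ker_proj by (simp add: clinear_on_def)
  have dom_Z: "norm (ker_proj (X h)) \<le> B.seminorm h" if h: "h \<in> H" for h
  proof (rule power2_le_imp_le)
    \<comment> \<open>On \<open>H\<close>, \<open>Y (A h) = X (A h) = W (X h)\<close>. Thus the
      squares of both sides of the goal contain the same term, minus the squared norm of
      \<open>W (X h)\<close>, and only this bound remains.\<close>
    have "norm (X h) \<le> M * norm h" using Y(2)[of h] Y(3)[OF h] by simp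
    from power_mono[OF this norm_ge_zero, of 2]
    show "(norm (ker_proj (X h)))\<^sup>2 \<le> (B.seminorm h)\<^sup>2"
      by (simp add: B.seminorm_power2 B_eq norm_ker_proj Y(3)[OF A(3)[OF h]] XA[OF h])
  qed (rule B.seminorm_nonneg)
  obtain Z where Z: "clinear_on UNIV Z" "\<And>h. h \<in> H \<Longrightarrow> Z h = ker_proj (X h)"
      "\<And>k. norm (Z k) \<le> B.seminorm k"
    using B.extend_dominated[OF H lin_Z dom_Z] by metis
  \<comment> \<open>\<open>Z\<close> may leave the kernel of \<open>W\<close> outside
    \<open>H\<close>; applying \<open>ker_proj\<close> again forces
    \<open>W (Y' k) = Y (A k)\<close>, and idempotence preserves the prescribed values on
    \<open>H\<close>.\<close>
  define Y' where "Y' k = W' (Y (A k)) + ker_proj (Z k)" for k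
  show ?thesis
  proof (rule that)
    show "clinear_on UNIV Y'"
      using lin' Y(1) A(1) Z(1) clinear_ker_proj
      by (simp add: clinear_on_def Y'_def scaleC_add_right)
    show "W (Y' k) = Y (A k)" for k
      by (simp add: Y'_def clinear_onD(1)[OF lin] right_inv W_ker_proj)
    show "Y' h = X h" if h: "h \<in> H" for h
      by (simp add: Y'_def Y(3)[OF A(3)[OF h]] XA[OF h] Z(2)[OF h] ker_proj_idem)
        (simp add: ker_proj_def)
    show "norm (Y' k) \<le> M * norm k" for k
    proof (rule power2_le_imp_le)
      have "(norm (ker_proj (Z k)))\<^sup>2 \<le> (norm (Z k))\<^sup>2" by (simp add: norm_ker_proj)
      also have "\<dots> \<le> B k k"
        using power_mono[OF Z(3)[of k] norm_ge_zero, of 2] by (simp add: B.seminorm_power2)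
      finally show "(norm (Y' k))\<^sup>2 \<le> (M * norm k)\<^sup>2"
        by (simp add: Y'_def norm_adj_add_ker B_eq)
    qed (simp add: M)
  qed
qed

theorem intertwining_extension:
  fixes A :: "'a::complex_inner \<Rightarrow> 'a" and X :: "'a \<Rightarrow> 'b"
  assumes H: "csubspace H" and X: "clinear_on H X" "\<And>h. h \<in> H \<Longrightarrow> norm (X h) \<le> M * norm h"
    and A: "clinear_on UNIV A" "\<And>k. norm (A k) \<le> norm k" "\<And>h. h \<in> H \<Longrightarrow> A h \<in> H"
    and XA: "\<And>h. h \<in> H \<Longrightarrow> X (A h) = W (X h)" and M: "0 \<le> M"
  obtains Y where "clinear_on UNIV Y" "\<And>k. norm (Y k) \<le> M * norm k"
    "\<And>h. h \<in> H \<Longrightarrow> Y h = X h" "\<And>k. Y (A k) = W (Y k)"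
proof -
  define P where "P Y \<longleftrightarrow> clinear_on UNIV Y \<and> (\<forall>k. norm (Y k) \<le> M * norm k) \<and> (\<forall>h\<in>H. Y h = X h)" for Y
  have "\<exists>Y. P Y"
  proof -
    obtain Y where "clinear_on UNIV Y" "\<And>h. h \<in> H \<Longrightarrow> Y h = X h"
      "\<And>k. norm (Y k) \<le> semi_form.seminorm (\<lambda>x y. M\<^sup>2 * ip x y) k"
      by (rule semi_form.extend_dominated[OF seminorm_scaled_ip(1)[OF M] H X(1)])
        (auto simp: seminorm_scaled_ip(2)[OF M] X(2))
    then show ?thesis by (auto simp: P_def seminorm_scaled_ip(2)[OF M])
  qed
  moreover have "\<exists>Y'. P Y' \<and> (\<forall>k. W (Y' k) = Y (A k))" if "P Y" for Y
  proof -
    from that have Y: "clinear_on UNIV Y" "\<And>k. norm (Y k) \<le> M * norm k" "\<And>h. h \<in> H \<Longrightarrow> Y h = X h"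
      by (auto simp: P_def)
    show ?thesis
      by (rule lifting_step[OF H X(1) A XA M Y]) (auto simp: P_def)
  qed
  ultimately have "\<exists>Y. \<forall>n. P (Y n) \<and> (\<forall>k. W (Y (Suc n) k) = Y n (A k))"
    by (intro dependent_nat_choice) auto
  then obtain Y where P: "\<And>n. P (Y n)" and step: "\<And>n k. W (Y (Suc n) k) = Y n (A k)"
    by blast
  have Y: "clinear_on UNIV (Y n)" "norm (Y n k) \<le> M * norm k" "h \<in> H \<Longrightarrow> Y n h = X h" for n k h
    using P[of n] by (auto simp: P_def)
  obtain L :: "(nat \<Rightarrow> real) \<Rightarrow> real" where
    L_add: "\<And>a b. bounded (range a) \<Longrightarrow> bounded (range b) \<Longrightarrow> L (\<lambda>n. a n + b n) = L a + L b" and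
    L_scale: "\<And>a c. bounded (range a) \<Longrightarrow> L (\<lambda>n. c * a n) = c * L a" and
    L_shift: "\<And>a. bounded (range a) \<Longrightarrow> L (\<lambda>n. a (Suc n)) = L a" and
    L_bound: "\<And>a C. (\<And>n. \<bar>a n\<bar> \<le> C) \<Longrightarrow> \<bar>L a\<bar> \<le> C" and
    L_const: "\<And>c. L (\<lambda>n. c) = c"
    by (rule banach_limit_exists) blast
  \<comment> \<open>For fixed \<open>k\<close> this is a bounded real-linear functional of
    \<open>l\<close>, since \<open>L\<close> respects uniform bounds; \<open>riesz\<close> turns it
    into the vector \<open>Yb k\<close>.\<close>
  define g where "g k l = L (\<lambda>n. ip (Y n k) l)" for k l
  have le: "\<bar>ip (Y n k) l\<bar> \<le> M * norm k * norm l" for n k l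
    using ip_Cauchy_Schwarz[of "Y n k" l] mult_right_mono[OF Y(2)[of n k] norm_ge_zero[of l]] by linarith
  then have bdd: "bounded (range (\<lambda>n. ip (Y n k) l))" for k l
    by (auto simp: bounded_iff)
  have "\<exists>y. \<forall>l. ip y l = g k l" for k
  proof (rule riesz)
    show "g k (x + y) = g k x + g k y" for x y
      by (simp add: g_def ip.form_add_right L_add bdd)
    show "g k (r *\<^sub>R x) = r * g k x" for r x
      by (simp add: g_def ip.form_scaleR_right L_scale bdd)
    show "\<bar>g k l\<bar> \<le> M * norm k * norm l" for l
      unfolding g_def by (rule L_bound) (rule le)
  qed
  then obtain Yb where Yb: "\<And>k l. ip (Yb k) l = g k l" by metis
  show ?thesis
  proof (rule that)
    show "clinear_on UNIV Yb" unfolding clinear_on_def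
    proof (intro conjI allI ballI)
      show "Yb (x + y) = Yb x + Yb y" for x y
        by (rule ip_eqI) (simp add: ip.form_add Yb g_def clinear_onD(1)[OF Y(1)] L_add bdd)
      show "Yb (c *\<^sub>C x) = c *\<^sub>C Yb x" for c x
        by (rule ip_eqI) (simp add: ip.form_scaleC Yb g_def clinear_onD(2)[OF Y(1)])
    qed
    show "norm (Yb k) \<le> M * norm k" for k
    proof (cases "Yb k = 0")
      case False
      \<comment> \<open>Testing against \<open>Yb k\<close> itself transfers the common bound of the
        \<open>Y n\<close> to the limit.\<close>
      have "norm (Yb k) * norm (Yb k) = g k (Yb k)"
        by (simp add: norm_power2_eq_ip Yb flip: power2_eq_square)
      also have "\<dots> \<le> M * norm k * norm (Yb k)"
        using L_bound[of "\<lambda>n. ip (Y n k) (Yb k)", OF le] by (simp add: g_def)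
      finally show ?thesis using False by simp
    qed (simp add: M)
    show "Yb h = X h" if "h \<in> H" for h
      by (rule ip_eqI) (simp add: Yb g_def Y(3)[OF that] L_const)
    show "Yb (A k) = W (Yb k)" for k
    proof (rule ip_eqI)
      fix l
      \<comment> \<open>The recursion trades \<open>A\<close> for \<open>W\<close> and an index
        shift. Once \<open>W\<close> is moved to the test vector, shift invariance of
        \<open>L\<close> removes the shift, which a mere subsequence limit could not absorb.\<close>
      have "ip (Yb (A k)) l = L (\<lambda>n. ip (Y (Suc n) k) (W' l))"
        by (simp add: Yb g_def step[symmetric] adj)
      also have "\<dots> = ip (W (Yb k)) l"
        using L_shift[OF bdd[of k "W' l"]] by (simp add: adj Yb g_def)
      finally show "ip (Yb (A k)) l = ip (W (Yb k)) l" .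
    qed
  qed
qed

end

section \<open>Operators on closed subspaces\<close>

lemma bop_on_clinear: "bop_on H K T \<Longrightarrow> clinear_on H T"
  by (simp add: bop_on_def clinear_on_def)

lemma closed_csubspace_imp_csubspace: "closed_csubspace H \<Longrightarrow> csubspace H"
  by (simp add: closed_csubspace_def csubspace_def)

lemma adjoint_on_ip: "adjoint_on UNIV T T' \<Longrightarrow> ip (T x) y = ip x (T' y)"
  by (simp add: adjoint_on_def ip_def)

lemma coisometry_imp_coisometric_op:
  assumes "coisometry W"
  obtains W' where "coisometric_op W W'"
  using assms bop_on_clinear adjoint_on_ip
  unfolding coisometry_def coisometric_op_def adjoint_on_def by metis

text \<open>Lets a unitary on the left of an intertwining relation be moved to the other side and
  absorbed into the co-isometry.\<close>

lemma coisometric_op_compose_unitary: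
  assumes W: "coisometric_op W W'" and U: "adjoint_on UNIV U U'" "\<And>x. U (U' x) = x" "\<And>x. U' (U x) = x"
  shows "coisometric_op (\<lambda>x. U' (W x)) (\<lambda>x. W' (U x))"
proof -
  interpret coisometric_op W W' by (rule W)
  have "clinear_on UNIV U" "clinear_on UNIV U'"
    using U(1) by (auto simp: adjoint_on_def intro: bop_on_clinear)
  moreover have "ip (U' x) y = ip x (U y)" for x y
    using adjoint_on_ip[OF U(1), of y x] by (simp add: ip_sym)
  ultimately show ?thesis
    using lin lin' U by unfold_locales (simp_all add: clinear_on_def adj right_inv)
qed

text \<open>Uniqueness of the foot holds because a second one differs from \<open>y\<close> by a
  vector of \<open>H\<close> orthogonal to \<open>H\<close>.\<close>

lemma proj_eq_self:
  assumes "csubspace H" "y \<in> H"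
  shows "proj H y = y"
  unfolding proj_def
proof (rule the_equality)
  have "cinner x 0 = 0" for x :: 'a
    using cinner_commute[of x 0] cinner_scaleC_left[of 0 0 x] scaleR_scaleC[of 0 "0::'a"] by simp
  then show "y \<in> H \<and> y - y \<in> orth H" using assms by (simp add: orth_def)
next
  fix x assume x: "x \<in> H \<and> y - x \<in> orth H"
  then have "y - x \<in> H" using assms csubspaceD(4) by blast
  with x have "cinner (y - x) (y - x) = 0" by (simp add: orth_def)
  then show "x = y" by (simp add: cinner_eq_zero_iff)
qed

section \<open>Operator norms on subspaces\<close>

lemma onorm_on_bound:
  assumes "bop_on H K T" "h \<in> H"
  shows "norm (T h) \<le> onorm_on H T * norm h"
proof -
  obtain C where C: "\<And>x. x \<in> H \<Longrightarrow> norm (T x) \<le> C * norm x"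
    using assms unfolding bop_on_def by blast
  \<comment> \<open>\<open>C\<close> may be negative when \<open>H\<close> is \<open>{0}\<close>,
    hence the absolute value; at \<open>x = 0\<close> the quotient is 0 by convention.\<close>
  have "norm (T x) / norm x \<le> \<bar>C\<bar>" if "x \<in> H" for x
  proof (cases "x = 0")
    case False
    have "norm (T x) \<le> \<bar>C\<bar> * norm x"
      by (rule order_trans[OF C[OF that]]) (simp add: mult_right_mono)
    then show ?thesis using False by (simp add: divide_le_eq)
  qed simp
  then have "bdd_above ((\<lambda>x. norm (T x) / norm x) ` H)" by (auto simp: bdd_above_def)
  then have le: "norm (T h) / norm h \<le> onorm_on H T"
    unfolding onorm_on_def by (rule cSUP_upper[OF assms(2)])
  show ?thesis
  proof (cases "h = 0")
    case True
    then show ?thesis using C[OF assms(2)] by simp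
  next
    case False
    then show ?thesis using le by (simp add: divide_le_eq)
  qed
qed

lemma onorm_on_le:
  assumes "H \<noteq> {}" "0 \<le> M" "\<And>h. h \<in> H \<Longrightarrow> norm (T h) \<le> M * norm h"
  shows "onorm_on H T \<le> M"
  unfolding onorm_on_def
proof (rule cSUP_least[OF assms(1)])
  fix h assume "h \<in> H"
  then show "norm (T h) / norm h \<le> M"
    using assms(2,3) by (cases "h = 0") (simp_all add: divide_le_eq)
qed

lemma onorm_on_nonneg:
  assumes "bop_on H K T" "csubspace H"
  shows "0 \<le> onorm_on H T"
proof (cases "\<exists>h\<in>H. h \<noteq> 0")
  case True
  then obtain h where "h \<in> H" "h \<noteq> 0" by blast
  then show ?thesis
    using order_trans[OF norm_ge_zero onorm_on_bound[OF assms(1)], of h] by (simp add: zero_le_mult_iff)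
next
  case False
  \<comment> \<open>The supremum then ranges over the single value 0 / 0, which is 0.\<close>
  then have "H = {0}" using csubspaceD(1)[OF assms(2)] by blast
  then show ?thesis by (simp add: onorm_on_def)
qed

lemma funpow_extends_on:
  assumes "\<And>h. h \<in> H \<Longrightarrow> T h \<in> H" "extends_on H W T" "h \<in> H"
  shows "(W ^^ n) h = (T ^^ n) h" "(T ^^ n) h \<in> H"
proof -
  have "(W ^^ n) h = (T ^^ n) h \<and> (T ^^ n) h \<in> H"
    using assms by (induction n) (auto simp: extends_on_def)
  then show "(W ^^ n) h = (T ^^ n) h" "(T ^^ n) h \<in> H" by auto
qed

context
  fixes H1 :: "'a::chilbert_space set" and H2 :: "'b::chilbert_space set"
    and T1 W1 :: "'a \<Rightarrow> 'a" and T2 W2 :: "'b \<Rightarrow> 'b" and X :: "'a \<Rightarrow> 'b"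
  assumes H1: "closed_csubspace H1" and H2: "closed_csubspace H2"
    and T1: "contraction_on H1 T1" and T2: "contraction_on H2 T2"
    and W1: "extends_on H1 W1 T1" and W2: "extends_on H2 W2 T2"
    and X: "bop_on H1 H2 X"
begin

text \<open>Powers of \<open>W1\<close> and \<open>W2\<close> agree with those of \<open>T1\<close>
  and \<open>T2\<close> on the subspaces, so all vectors concerned lie in \<open>H2\<close>, where
  \<open>proj H2\<close> is the identity.\<close>

lemma dilation_of_extension:
  assumes "extends_on H1 Y X"
  shows "\<forall>n. \<forall>h\<in>H1. (T2 ^^ n) (X h) = proj H2 ((W2 ^^ n) (Y h))"
    and "\<forall>n. \<forall>h\<in>H1. X ((T1 ^^ n) h) = proj H2 (Y ((W1 ^^ n) h))"
proof -
  note sub = closed_csubspace_imp_csubspace[OF H2]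
  have inv: "\<And>h. h \<in> H1 \<Longrightarrow> T1 h \<in> H1" "\<And>h. h \<in> H2 \<Longrightarrow> T2 h \<in> H2" "\<And>h. h \<in> H1 \<Longrightarrow> X h \<in> H2"
    using T1 T2 X by (auto simp: contraction_on_def bop_on_def)
  have Y: "Y h = X h" if "h \<in> H1" for h using assms that by (simp add: extends_on_def)
  show "\<forall>n. \<forall>h\<in>H1. (T2 ^^ n) (X h) = proj H2 ((W2 ^^ n) (Y h))"
    using funpow_extends_on[OF inv(2) W2 inv(3)] by (simp add: Y proj_eq_self[OF sub])
  show "\<forall>n. \<forall>h\<in>H1. X ((T1 ^^ n) h) = proj H2 (Y ((W1 ^^ n) h))"
    using funpow_extends_on[OF inv(1) W1] inv(3) by (simp add: Y proj_eq_self[OF sub])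
qed

text \<open>The bound \<open>M\<close> is taken to be the exact norm of \<open>X\<close>; the
  opposite norm inequality holds because \<open>Y\<close> restricts to \<open>X\<close>.\<close>

lemma intertwining_dilation:
  fixes A :: "'a \<Rightarrow> 'a" and V V' :: "'b \<Rightarrow> 'b"
  assumes V: "coisometric_op V V'" and A: "contraction_on UNIV A" "\<And>h. h \<in> H1 \<Longrightarrow> A h \<in> H1"
    and XA: "\<And>h. h \<in> H1 \<Longrightarrow> X (A h) = V (X h)"
  shows "\<exists>Y. bop_on UNIV UNIV Y \<and> extends_on H1 Y X \<and> (\<forall>k. Y (A k) = V (Y k))
          \<and> (\<forall>n. \<forall>h\<in>H1. (T2 ^^ n) (X h) = proj H2 ((W2 ^^ n) (Y h)))
          \<and> (\<forall>n. \<forall>h\<in>H1. X ((T1 ^^ n) h) = proj H2 (Y ((W1 ^^ n) h)))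
          \<and> onorm_on UNIV Y = onorm_on H1 X"
proof -
  let ?M = "onorm_on H1 X"
  note sub = closed_csubspace_imp_csubspace[OF H1]
  have M: "0 \<le> ?M" by (rule onorm_on_nonneg[OF X sub])
  have A': "clinear_on UNIV A" "\<And>k. norm (A k) \<le> norm k"
    using A(1) bop_on_clinear by (auto simp: contraction_on_def)
  obtain Y where Y: "clinear_on UNIV Y" "\<And>k. norm (Y k) \<le> ?M * norm k"
    "\<And>h. h \<in> H1 \<Longrightarrow> Y h = X h" "\<And>k. Y (A k) = V (Y k)"
    using coisometric_op.intertwining_extension[OF V sub bop_on_clinear[OF X] onorm_on_bound[OF X] A' A(2) XA M]
    by metis
  have bop: "bop_on UNIV UNIV Y" using Y(1,2) by (auto simp: bop_on_def clinear_on_def)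
  have ext: "extends_on H1 Y X" using Y(3) by (simp add: extends_on_def)
  have "onorm_on UNIV Y \<le> ?M" by (rule onorm_on_le) (simp_all add: M Y(2))
  moreover have "?M \<le> onorm_on UNIV Y"
  proof (rule onorm_on_le)
    show "H1 \<noteq> {}" using csubspaceD(1)[OF sub] by blast
    show "0 \<le> onorm_on UNIV Y" by (rule onorm_on_nonneg[OF bop csubspace_UNIV])
    show "norm (X h) \<le> onorm_on UNIV Y * norm h" if "h \<in> H1" for h
      using onorm_on_bound[OF bop, of h] Y(3)[OF that] by simp
  qed
  ultimately show ?thesis using bop ext Y(4) dilation_of_extension[OF ext] by force
qed

end

lemma contraction_on_compose:
  assumes "contraction_on H S" "contraction_on H T"
  shows "contraction_on H (\<lambda>x. S (T x))"
proof -
  have "norm (S (T x)) \<le> norm x" if "x \<in> H" for x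
    using assms that unfolding contraction_on_def bop_on_def by (meson order_trans)
  moreover from this have "\<exists>C. \<forall>x\<in>H. norm (S (T x)) \<le> C * norm x"
    by (intro exI[of _ 1]) simp
  ultimately show ?thesis
    using assms by (simp add: contraction_on_def bop_on_def)
qed

theorem mainTheorem6:
  fixes H1 :: "'a::chilbert_space set" and H2 :: "'b::chilbert_space set"
    and T1 W1 :: "'a \<Rightarrow> 'a" and T2 W2 :: "'b \<Rightarrow> 'b" and X :: "'a \<Rightarrow> 'b"
  assumes H1: "closed_csubspace H1" and H2: "closed_csubspace H2"
    and T1: "contraction_on H1 T1" and T2: "contraction_on H2 T2"
    and W1: "bop_on UNIV UNIV W1" "coisometry W1" "extends_on H1 W1 T1"
    and W2: "bop_on UNIV UNIV W2" "coisometry W2" "extends_on H2 W2 T2"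
    and X: "bop_on H1 H2 X"
  shows
   "(\<forall>(Q :: 'a \<Rightarrow> 'a) Qb.
       contraction_on H1 Q \<and> contraction_on UNIV Qb \<and> reduces H1 Qb \<and> extends_on H1 Qb Q
       \<and> (\<forall>h\<in>H1. X (T1 (Q h)) = T2 (X h)) \<longrightarrow>
       (\<exists>Y. bop_on UNIV UNIV Y \<and> extends_on H1 Y X \<and> (\<forall>k. Y (W1 (Qb k)) = W2 (Y k))
          \<and> (\<forall>n. \<forall>h\<in>H1. (T2 ^^ n) (X h) = proj H2 ((W2 ^^ n) (Y h)))
          \<and> (\<forall>n. \<forall>h\<in>H1. X ((T1 ^^ n) h) = proj H2 (Y ((W1 ^^ n) h)))
          \<and> onorm_on UNIV Y = onorm_on H1 X))
  \<and> (\<forall>(Q :: 'a \<Rightarrow> 'a) Qb.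
       contraction_on H1 Q \<and> contraction_on UNIV Qb \<and> reduces H1 Qb \<and> extends_on H1 Qb Q
       \<and> (\<forall>h\<in>H1. X (Q (T1 h)) = T2 (X h)) \<longrightarrow>
       (\<exists>Y. bop_on UNIV UNIV Y \<and> extends_on H1 Y X \<and> (\<forall>k. Y (Qb (W1 k)) = W2 (Y k))
          \<and> (\<forall>n. \<forall>h\<in>H1. (T2 ^^ n) (X h) = proj H2 ((W2 ^^ n) (Y h)))
          \<and> (\<forall>n. \<forall>h\<in>H1. X ((T1 ^^ n) h) = proj H2 (Y ((W1 ^^ n) h)))
          \<and> onorm_on UNIV Y = onorm_on H1 X))
  \<and> (\<forall>(Q :: 'b \<Rightarrow> 'b) Qb.
       unitary_on H2 Q \<and> unitary_on UNIV Qb \<and> reduces H2 Qb \<and> extends_on H2 Qb Q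
       \<and> (\<forall>h\<in>H1. Q (X (T1 h)) = T2 (X h)) \<longrightarrow>
       (\<exists>Y. bop_on UNIV UNIV Y \<and> extends_on H1 Y X \<and> (\<forall>k. Qb (Y (W1 k)) = W2 (Y k))
          \<and> (\<forall>n. \<forall>h\<in>H1. (T2 ^^ n) (X h) = proj H2 ((W2 ^^ n) (Y h)))
          \<and> (\<forall>n. \<forall>h\<in>H1. X ((T1 ^^ n) h) = proj H2 (Y ((W1 ^^ n) h)))
          \<and> onorm_on UNIV Y = onorm_on H1 X))"
proof -
  obtain W1' where W1': "coisometric_op W1 W1'" using coisometry_imp_coisometric_op[OF W1(2)] by blast
  obtain W2' where W2': "coisometric_op W2 W2'" using coisometry_imp_coisometric_op[OF W2(2)] by blast
  have W1_contr: "contraction_on UNIV W1"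
    using W1(1) coisometric_op.norm_W_le[OF W1'] by (simp add: contraction_on_def)
  have inv: "\<And>h. h \<in> H1 \<Longrightarrow> T1 h \<in> H1" "\<And>h. h \<in> H1 \<Longrightarrow> X h \<in> H2"
    using T1 X by (auto simp: contraction_on_def bop_on_def)
  have W1_eq: "W1 h = T1 h" if "h \<in> H1" for h using W1(3) that by (simp add: extends_on_def)
  have W2_eq: "W2 (X h) = T2 (X h)" if "h \<in> H1" for h
    using W2(3) inv(2)[OF that] by (simp add: extends_on_def)
  note lift = intertwining_dilation[OF H1 H2 T1 T2 W1(3) W2(3) X]
  show ?thesis
  proof (intro conjI allI impI; elim conjE)
    fix Q Qb :: "'a \<Rightarrow> 'a"
    assume Q: "contraction_on H1 Q" and Qb: "contraction_on UNIV Qb" and ext: "extends_on H1 Qb Q"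
      and eq: "\<forall>h\<in>H1. X (T1 (Q h)) = T2 (X h)"
    have Qb_eq: "Qb h = Q h" "Q h \<in> H1" if "h \<in> H1" for h
      using Q ext that by (auto simp: extends_on_def contraction_on_def bop_on_def)
    \<comment> \<open>On \<open>H1\<close>, \<open>W1 (Qb h)\<close> is \<open>T1 (Q h)\<close> and
      \<open>W2 (X h)\<close> is \<open>T2 (X h)\<close>, so \<open>eq\<close> is the relation that
      \<open>lift\<close> requires for \<open>A = W1 Qb\<close>.\<close>
    show "\<exists>Y. bop_on UNIV UNIV Y \<and> extends_on H1 Y X \<and> (\<forall>k. Y (W1 (Qb k)) = W2 (Y k))
          \<and> (\<forall>n. \<forall>h\<in>H1. (T2 ^^ n) (X h) = proj H2 ((W2 ^^ n) (Y h)))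
          \<and> (\<forall>n. \<forall>h\<in>H1. X ((T1 ^^ n) h) = proj H2 (Y ((W1 ^^ n) h)))
          \<and> onorm_on UNIV Y = onorm_on H1 X"
      by (rule lift[OF W2' contraction_on_compose[OF W1_contr Qb]])
        (simp_all add: Qb_eq W1_eq W2_eq inv eq)
  next
    fix Q Qb :: "'a \<Rightarrow> 'a"
    assume Q: "contraction_on H1 Q" and Qb: "contraction_on UNIV Qb" and ext: "extends_on H1 Qb Q"
      and eq: "\<forall>h\<in>H1. X (Q (T1 h)) = T2 (X h)"
    have Qb_eq: "Qb h = Q h" "Q h \<in> H1" if "h \<in> H1" for h
      using Q ext that by (auto simp: extends_on_def contraction_on_def bop_on_def)
    show "\<exists>Y. bop_on UNIV UNIV Y \<and> extends_on H1 Y X \<and> (\<forall>k. Y (Qb (W1 k)) = W2 (Y k))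
          \<and> (\<forall>n. \<forall>h\<in>H1. (T2 ^^ n) (X h) = proj H2 ((W2 ^^ n) (Y h)))
          \<and> (\<forall>n. \<forall>h\<in>H1. X ((T1 ^^ n) h) = proj H2 (Y ((W1 ^^ n) h)))
          \<and> onorm_on UNIV Y = onorm_on H1 X"
      by (rule lift[OF W2' contraction_on_compose[OF Qb W1_contr]])
        (simp_all add: Qb_eq W1_eq W2_eq inv eq)
  next
    fix Q Qb :: "'b \<Rightarrow> 'b"
    assume Qb: "unitary_on UNIV Qb" and ext: "extends_on H2 Qb Q"
      and eq: "\<forall>h\<in>H1. Q (X (T1 h)) = T2 (X h)"
    obtain Qb' where Qb': "adjoint_on UNIV Qb Qb'" "\<And>x. Qb (Qb' x) = x" "\<And>x. Qb' (Qb x) = x"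
      using Qb by (auto simp: unitary_on_def)
    have "X (T1 h) = Qb' (T2 (X h))" if h: "h \<in> H1" for h
      using eq h ext inv(2)[OF inv(1)[OF h]] Qb'(3)[of "X (T1 h)"] by (simp add: extends_on_def)
    then have XW: "X (W1 h) = Qb' (W2 (X h))" if "h \<in> H1" for h
      using that by (simp add: W1_eq W2_eq)
    \<comment> \<open>This rewrites the goal \<open>Qb (Y (W1 k)) = W2 (Y k)\<close> as
      \<open>Y (W1 k) = Qb' (W2 (Y k))\<close>, an intertwining of \<open>W1\<close> with the
      co-isometry \<open>Qb' W2\<close>.\<close>
    have "Qb y = W2 k \<longleftrightarrow> y = Qb' (W2 k)" for y k using Qb'(2,3) by metis
    then show "\<exists>Y. bop_on UNIV UNIV Y \<and> extends_on H1 Y X \<and> (\<forall>k. Qb (Y (W1 k)) = W2 (Y k))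
          \<and> (\<forall>n. \<forall>h\<in>H1. (T2 ^^ n) (X h) = proj H2 ((W2 ^^ n) (Y h)))
          \<and> (\<forall>n. \<forall>h\<in>H1. X ((T1 ^^ n) h) = proj H2 (Y ((W1 ^^ n) h)))
          \<and> onorm_on UNIV Y = onorm_on H1 X"
      using lift[OF coisometric_op_compose_unitary[OF W2' Qb'] W1_contr _ XW]
      by (simp add: W1_eq inv)
  qed
qed

end
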